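(* Let $D_0,R,\mu_0>0$ be constants such that: (i) the coefficients of the Maclaurin series $\mathbf f(t,\mathbf x)=\sum_{\alpha\in\mathbb Z_+^d\setminus\{0\}}\mathbf f_\alpha(t)\,\mathbf x_\alpha$, $\mathbf f_\alpha(t)=[f_{1,\alpha}(t),\dots,f_{d,\alpha}(t)]^T$, satisfy $\sup_{t\ge t_0}\sum_{j=1}^d\sum_{\alpha\in\mathbb Z_k^d}|f_{j,\alpha}(t)|\le D_0R^{-k}$ for all $k\ge1$; (ii) the Jacobian $\nabla\mathbf f(t,0)=[\mathbf f_{\mathbf e_1}(t),\dots,\mathbf f_{\mathbf e_d}(t)]^T$ at the origin is a time-independent diagonal matrix whose diagonal entries $\lambda_{\mathbf e_1},\dots,\lambda_{\mathbf e_d}$ satisfy $\lambda_{\mathbf e_j}\le-\mu_0$ for all $1\le j\le d$. Let $\mathbf x(t)$ be the continuous solution of $\dot{\mathbf x}(t)=\mathbf f(t,\mathbf x(t))$, $t\ge t_0$, with $\mathbf x(t_0)=\mathbf x_0$ satisfying $$0<\|\mathbf x_0\|_2<\frac{R^2\mu_0}{D_0+R\mu_0},$$ and for $N\ge 1$ let $\mathbf y_{1,N}(t)$ be the first block of the solution of the order-$N$ finite-section approximation of the Carleman linearization (defined in the context). Then $$\|\mathbf y_{1,N}(t)-\mathbf x(t)\|_\infty\le\|\mathbf x_0\|_2\left(\frac{(D_0+R\mu_0)\|\mathbf x_0\|_2}{R^2\mu_0}\right)^N$$ for all $N\ge1$ and all $t\ge t_0$.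
   Context: Notation: $\mathbb Z_+^d$ is the set of $d$-dimensional vectors of non-negative integers; $|\alpha|=\alpha_1+\dots+\alpha_d$; $\mathbb Z_k^d=\{\alpha\in\mathbb Z_+^d: |\alpha|=k\}$; $\mathbf x_\alpha=x_1^{\alpha_1}\cdots x_d^{\alpha_d}$; $\mathbf e_1,\dots,\mathbf e_d$ is the standard basis of $\mathbb R^d$; $\|\mathbf x\|_\infty=\max_j|x_j|$; $\|\mathbf x\|_2$ is the Euclidean norm. The system is $\dot{\mathbf x}(t)=\mathbf f(t,\mathbf x(t))$, $t\ge t_0$, $\mathbf x(t)\in\mathbb R^d$, where $\mathbf f(t,\cdot)$ is analytic near $0$, $\mathbf f(t,0)=0$, and $\mathbf f$ is given by its Maclaurin series (under (i) the series converges absolutely for $\|\mathbf x\|_\infty<R$ and the expansion is understood to hold there). Carleman blocks: put $f_{j,\alpha}(t)=0$ whenever $\alpha\notin\mathbb Z_+^d\setminus\{0\}$, and for $k,l\ge1$ let $$\mathbf A_{k,l}(t)=\Big[\sum_{j=1}^d\alpha_jf_{j,\beta-\alpha+\mathbf e_j}(t)\Big]_{\alpha\in\mathbb Z_k^d,\ \beta\in\mathbb Z_l^d}.$$ Finite-section approximation of order $N$: the finite linear system $$\dot{\mathbf y}_{k,N}(t)=\sum_{l=k}^N\mathbf A_{k,l}(t)\,\mathbf y_{l,N}(t),\qquad \mathbf y_{k,N}(t_0)=[(\mathbf x_0)_\alpha]_{\alpha\in\mathbb Z_k^d},\qquad 1\le k\le N,$$ for $t\ge t_0$, with $\mathbf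 y_{k,N}(t)$ indexed by $\mathbb Z_k^d$. The first block $\mathbf y_{1,N}(t)$ is identified with a vector in $\mathbb R^d$ via $\mathbb Z_1^d=\{\mathbf e_1,\dots,\mathbf e_d\}$. *)

theory Defs
  imports "HOL-Analysis.Analysis"
begin

text \<open>Multi-indices in \<open>d\<close> variables are functions from a finite index type \<open>'d\<close>
  (of cardinality \<open>d\<close>) to the natural numbers.\<close>

type_synonym 'd mindex = "'d \<Rightarrow> nat"

definition mindices :: "nat \<Rightarrow> ('d::finite) mindex set" where
  "mindices k = {\<alpha>. (\<Sum>i\<in>UNIV. \<alpha> i) = k}"

definition mindex_unit :: "'d \<Rightarrow> 'd mindex" where
  "mindex_unit j = (\<lambda>i. if i = j then 1 else 0)"

definition mpower :: "real ^ 'd \<Rightarrow> ('d::finite) mindex \<Rightarrow> real" where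
  "mpower x \<alpha> = (\<Prod>i\<in>UNIV. (x $ i) ^ \<alpha> i)"

text \<open>A coefficient family \<open>F\<close> has \<open>F \<alpha> t $ j\<close> as its \<open>j\<close>-th component of the \<open>\<alpha>\<close>-th
  Maclaurin coefficient at time \<open>t\<close>.  The extension by zero takes integer vectors as indices,
  since \<open>\<beta> - \<alpha> + e\<^sub>j\<close> may have negative entries; \<open>F\<close> is never used at the index zero.\<close>

definition coeff_ext ::
    "('d mindex \<Rightarrow> real \<Rightarrow> real ^ 'd) \<Rightarrow> 'd::finite \<Rightarrow> ('d \<Rightarrow> int) \<Rightarrow> real \<Rightarrow> real" where
  "coeff_ext F j \<gamma> t =
     (if (\<forall>i. 0 \<le> \<gamma> i) \<and> \<gamma> \<noteq> (\<lambda>_. 0) then F (\<lambda>i. nat (\<gamma> i)) t $ j else 0)"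

text \<open>The block \<open>A\<^sub>k\<^sub>,\<^sub>l(t)\<close> as a matrix with rows in \<open>mindices k\<close> and columns in
  \<open>mindices l\<close>; entries outside this range are zero by convention and are not used.\<close>

definition carleman_block ::
    "('d mindex \<Rightarrow> real \<Rightarrow> real ^ 'd) \<Rightarrow> nat \<Rightarrow> nat \<Rightarrow> real
      \<Rightarrow> ('d::finite) mindex \<Rightarrow> 'd mindex \<Rightarrow> real" where
  "carleman_block F k l t \<alpha> \<beta> =
     (if \<alpha> \<in> mindices k \<and> \<beta> \<in> mindices l
      then (\<Sum>j\<in>UNIV. real (\<alpha> j) *
              coeff_ext F j (\<lambda>i. int (\<beta> i) - int (\<alpha> i) + int (mindex_unit j i)) t)
      else 0)"

text \<open>\<open>y k t \<alpha>\<close> is the \<open>\<alpha>\<close>-entry of the \<open>k\<close>-th block at time \<open>t\<close>; only \<open>1 \<le> k \<le> N\<close> and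
  \<open>\<alpha> \<in> mindices k\<close> matter.  The derivative at \<open>t\<^sub>0\<close> is one-sided.\<close>

definition finite_section_solution ::
    "('d mindex \<Rightarrow> real \<Rightarrow> real ^ 'd) \<Rightarrow> real \<Rightarrow> real ^ 'd \<Rightarrow> nat
      \<Rightarrow> (nat \<Rightarrow> real \<Rightarrow> ('d::finite) mindex \<Rightarrow> real) \<Rightarrow> bool" where
  "finite_section_solution F t0 x0 N y \<longleftrightarrow>
     (\<forall>k\<in>{1..N}. \<forall>\<alpha>\<in>mindices k.
        y k t0 \<alpha> = mpower x0 \<alpha> \<and>
        (\<forall>t\<ge>t0. ((\<lambda>s. y k s \<alpha>) has_real_derivative
            (\<Sum>l=k..N. \<Sum>\<beta>\<in>mindices l. carleman_block F k l t \<alpha> \<beta> * y l t \<beta>))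
            (at t within {t0..})))"

definition first_block :: "(nat \<Rightarrow> real \<Rightarrow> ('d::finite) mindex \<Rightarrow> real) \<Rightarrow> real \<Rightarrow> real ^ 'd" where
  "first_block y t = (\<chi> j. y 1 t (mindex_unit j))"

end

theory Submission
  imports Defs
begin

text \<open>Write \<open>M\<close> for the Euclidean norm of \<open>x0\<close>, \<open>\<rho> = M / R\<close>, \<open>a = D0 / (\<mu>0 R)\<close> and
  \<open>q = (1 + a) \<rho>\<close>, which is the ratio in the claimed bound; the smallness of \<open>x0\<close> says
  \<open>q < 1\<close>.

  The trajectory stays in the cube of radius \<open>M\<close>: on a cube of radius \<open>m\<close> with
  \<open>m < R\<^sup>2 \<mu>0 / (D0 + R \<mu>0)\<close> the nonlinear part of the field has components at most
  \<open>D0 (m / R)\<^sup>2 / (1 - m / R) < \<mu>0 m\<close>, so linear damping at rate \<open>\<mu>0\<close> prevents a first exit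
  (\<open>infnorm_trajectory_le\<close>).

  The monomials of the true solution satisfy the infinite Carleman system. Hence the errors
  \<open>e\<^sub>\<alpha> = x\<^sub>\<alpha> - y\<^sub>\<alpha>\<close>, for \<open>\<bar>\<alpha>\<bar> = k \<le> N\<close>, solve the upper triangular finite section with zero
  initial values and, as forcing, the blocks of degree above \<open>N\<close> applied to the monomials of
  \<open>x\<close>. The diagonal block is diagonal with entries at most \<open>- k \<mu>0\<close>, and every row of the block
  \<open>A\<^sub>k\<^sub>,\<^sub>l\<close> has absolute sum at most \<open>k D0 R\<^sup>k\<^sup>-\<^sup>l\<^sup>-\<^sup>1\<close>. The common factor \<open>k\<close> cancels, so constants
  \<open>C\<^sub>k\<close> bound the errors as soon as
  \<open>\<mu>0 C\<^sub>k \<ge> \<Sum>\<^sub>k\<^sub><\<^sub>l\<^sub>\<le>\<^sub>N D0 R\<^sup>k\<^sup>-\<^sup>l\<^sup>-\<^sup>1 C\<^sub>l + \<Sum>\<^sub>l\<^sub>>\<^sub>N D0 R\<^sup>k\<^sup>-\<^sup>l\<^sup>-\<^sup>1 M\<^sup>l\<close>.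
  The choice \<open>C\<^sub>k = M\<^sup>k q\<^sup>N\<^sup>+\<^sup>1\<^sup>-\<^sup>k\<close> satisfies this by a geometric sum
  (\<open>majorant_is_supersolution\<close>), and \<open>C\<^sub>1 = M q\<^sup>N\<close> is the claim. Since the system is triangular,
  the comparison is a descending induction on \<open>k\<close> in which each scalar equation is controlled
  separately (\<open>carleman_error_le\<close>).\<close>

section \<open>Multi-indices and monomials\<close>

lemma finite_mindices [simp]: "finite (mindices k :: ('d::finite) mindex set)"
proof (rule finite_subset)
  show "mindices k \<subseteq> (PiE UNIV (\<lambda>_. {..k}) :: 'd mindex set)"
    by (auto simp: mindices_def PiE_iff intro: member_le_sum)
qed (simp add: finite_PiE)

lemma mindex_unit_in_mindices: "mindex_unit j \<in> mindices 1"
  by (simp add: mindices_def mindex_unit_def)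

lemma mindices_1: "mindices 1 = range (mindex_unit :: 'd::finite \<Rightarrow> 'd mindex)"
proof (intro equalityI subsetI)
  fix \<gamma> :: "'d mindex" assume "\<gamma> \<in> mindices 1"
  hence s: "(\<Sum>i\<in>UNIV. \<gamma> i) = 1" by (simp add: mindices_def)
  then obtain j where j: "\<gamma> j \<noteq> 0" by (metis sum.neutral zero_neq_one)
  have s2: "\<gamma> j + (\<Sum>i\<in>UNIV - {j}. \<gamma> i) = 1"
    using s by (simp add: sum.remove[of UNIV j])
  with j have "\<gamma> j = 1" "(\<Sum>i\<in>UNIV - {j}. \<gamma> i) = 0" by linarith+
  hence "\<gamma> = mindex_unit j" by (auto simp: mindex_unit_def fun_eq_iff)
  thus "\<gamma> \<in> range mindex_unit" by simp
qed (use mindex_unit_in_mindices in auto)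

lemma inj_mindex_unit: "inj mindex_unit"
  by (auto simp: inj_on_def mindex_unit_def fun_eq_iff split: if_splits)

lemma mpower_unit: "mpower z (mindex_unit j) = z $ j"
proof -
  have "mpower z (mindex_unit j) = (\<Prod>i\<in>UNIV. if i = j then z $ i else 1)"
    unfolding mpower_def mindex_unit_def by (rule prod.cong) auto
  thus ?thesis by simp
qed

lemma mpower_add: "mpower z (\<lambda>i. \<alpha> i + \<beta> i) = mpower z \<alpha> * mpower z \<beta>"
  by (simp add: mpower_def power_add prod.distrib)

lemma abs_mpower_le:
  assumes "\<alpha> \<in> mindices k" "\<And>i. \<bar>z $ i\<bar> \<le> m"
  shows "\<bar>mpower z \<alpha>\<bar> \<le> m ^ k"
proof -
  have "\<bar>mpower z \<alpha>\<bar> = (\<Prod>i\<in>UNIV. \<bar>z $ i\<bar> ^ \<alpha> i)"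
    by (simp add: mpower_def abs_prod power_abs)
  also have "\<dots> \<le> (\<Prod>i\<in>UNIV. m ^ \<alpha> i)"
    by (intro prod_mono conjI power_mono assms(2)) auto
  also have "\<dots> = m ^ k"
    using assms(1) by (simp add: mindices_def flip: power_sum)
  finally show ?thesis .
qed

text \<open>The multi-index \<open>\<alpha> - e\<^sub>j\<close>. If \<open>\<alpha> j = 0\<close>, truncated subtraction yields \<open>\<alpha>\<close> itself; the formulas
  below carry the factor \<open>\<alpha> j\<close>, which then removes the term.\<close>

definition lower_index :: "'d mindex \<Rightarrow> 'd \<Rightarrow> 'd mindex" where
  "lower_index \<alpha> j = (\<lambda>i. \<alpha> i - mindex_unit j i)"

lemma lower_index_add_unit:
  "\<alpha> j > 0 \<Longrightarrow> (\<lambda>i. lower_index \<alpha> j i + mindex_unit j i) = \<alpha>"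
  by (auto simp: lower_index_def mindex_unit_def fun_eq_iff)

lemma lower_index_in_mindices:
  fixes \<alpha> :: "('d::finite) mindex"
  assumes "\<alpha> \<in> mindices k" "\<alpha> j > 0"
  shows "lower_index \<alpha> j \<in> mindices (k - 1)"
proof -
  have "k = (\<Sum>i\<in>UNIV. lower_index \<alpha> j i + mindex_unit j i)"
    using lower_index_add_unit[of \<alpha> j, OF assms(2)] assms(1)
    by (simp add: mindices_def fun_eq_iff)
  also have "\<dots> = (\<Sum>i\<in>UNIV. lower_index \<alpha> j i) + 1"
    by (simp add: sum.distrib mindex_unit_def)
  finally show ?thesis by (simp add: mindices_def)
qed

lemma has_real_derivative_mpower:
  fixes x :: "real \<Rightarrow> real ^ 'd::finite"
  assumes "\<And>j. ((\<lambda>s. x s $ j) has_real_derivative v $ j) (at t)"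
  shows "((\<lambda>s. mpower (x s) \<alpha>) has_real_derivative
           (\<Sum>j\<in>UNIV. real (\<alpha> j) * mpower (x t) (lower_index \<alpha> j) * v $ j)) (at t)"
proof -
  have "((\<lambda>s. mpower (x s) \<alpha>) has_real_derivative
      (\<Sum>j\<in>UNIV. (real (\<alpha> j) * (x t $ j) ^ (\<alpha> j - 1) * v $ j) *
         (\<Prod>i\<in>UNIV - {j}. (x t $ i) ^ \<alpha> i))) (at t)"
    unfolding mpower_def
    by (intro has_field_derivative_prod)
       (auto intro!: derivative_eq_intros assms)
  also have "(\<Sum>j\<in>UNIV. (real (\<alpha> j) * (x t $ j) ^ (\<alpha> j - 1) * v $ j) *
         (\<Prod>i\<in>UNIV - {j}. (x t $ i) ^ \<alpha> i))
      = (\<Sum>j\<in>UNIV. real (\<alpha> j) * mpower (x t) (lower_index \<alpha> j) * v $ j)"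
  proof (rule sum.cong[OF refl])
    fix j :: 'd
    have "mpower (x t) (lower_index \<alpha> j) =
        (x t $ j) ^ (\<alpha> j - 1) * (\<Prod>i\<in>UNIV - {j}. (x t $ i) ^ lower_index \<alpha> j i)"
      unfolding mpower_def
      by (subst prod.remove[of UNIV j]) (auto simp: lower_index_def mindex_unit_def)
    also have "(\<Prod>i\<in>UNIV - {j}. (x t $ i) ^ lower_index \<alpha> j i) = (\<Prod>i\<in>UNIV - {j}. (x t $ i) ^ \<alpha> i)"
      by (rule prod.cong) (auto simp: lower_index_def mindex_unit_def)
    finally show "(real (\<alpha> j) * (x t $ j) ^ (\<alpha> j - 1) * v $ j) *
         (\<Prod>i\<in>UNIV - {j}. (x t $ i) ^ \<alpha> i)
       = real (\<alpha> j) * mpower (x t) (lower_index \<alpha> j) * v $ j" by simp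
  qed
  finally show ?thesis .
qed

section \<open>Rows of the Carleman blocks\<close>

text \<open>The entries of one row \<open>\<alpha>\<close> of a Carleman block, paired with a vector \<open>v\<close> indexed by
  multi-indices. The columns are enumerated by \<open>\<gamma> = \<beta> - \<alpha> + e\<^sub>j\<close> in place of \<open>\<beta>\<close>, so that only
  coefficients of the homogeneous part of degree \<open>p\<close> occur and no integer index is needed.\<close>

definition carleman_row ::
    "('d mindex \<Rightarrow> real \<Rightarrow> real ^ 'd) \<Rightarrow> real \<Rightarrow> nat \<Rightarrow> ('d::finite) mindex
      \<Rightarrow> ('d mindex \<Rightarrow> real) \<Rightarrow> real" where
  "carleman_row F t p \<alpha> v =
     (\<Sum>j\<in>UNIV. real (\<alpha> j) *
        (\<Sum>\<gamma>\<in>mindices p. F \<gamma> t $ j * v (\<lambda>i. lower_index \<alpha> j i + \<gamma> i)))"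

text \<open>For fixed \<open>j\<close> with \<open>\<alpha> j > 0\<close> the map \<open>\<gamma> \<mapsto> \<alpha> - e\<^sub>j + \<gamma>\<close> is injective from degree \<open>l - k + 1\<close>
  into degree \<open>l\<close>; for the columns outside its image \<open>\<beta> - \<alpha> + e\<^sub>j\<close> has a negative entry, where the
  extended coefficient is zero.\<close>

lemma carleman_block_eq_row:
  fixes \<alpha> :: "('d::finite) mindex"
  assumes \<alpha>: "\<alpha> \<in> mindices k" and "k \<ge> 1" "k \<le> l"
  shows "(\<Sum>\<beta>\<in>mindices l. carleman_block F k l t \<alpha> \<beta> * v \<beta>) = carleman_row F t (Suc (l - k)) \<alpha> v"
proof -
  let ?g = "\<lambda>j \<beta>. (\<lambda>i. int (\<beta> i) - int (\<alpha> i) + int (mindex_unit j i))"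
  have column: "(\<Sum>\<beta>\<in>mindices l. coeff_ext F j (?g j \<beta>) t * v \<beta>) =
      (\<Sum>\<gamma>\<in>mindices (Suc (l - k)). F \<gamma> t $ j * v (\<lambda>i. lower_index \<alpha> j i + \<gamma> i))"
    if j: "\<alpha> j > 0" for j
  proof -
    let ?h = "\<lambda>\<gamma>. (\<lambda>i. lower_index \<alpha> j i + \<gamma> i)"
    have low: "int (lower_index \<alpha> j i) = int (\<alpha> i) - int (mindex_unit j i)" for i
      using j by (auto simp: lower_index_def mindex_unit_def)
    have sumlow: "(\<Sum>i\<in>UNIV. lower_index \<alpha> j i) = k - 1"
      using lower_index_in_mindices[of \<alpha> k j] \<alpha> j by (simp add: mindices_def)
    have img: "?h ` mindices (Suc (l - k)) \<subseteq> mindices l"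
      using sumlow assms by (auto simp: mindices_def sum.distrib)
    have inj: "inj_on ?h (mindices (Suc (l - k)))"
      by (auto simp: inj_on_def fun_eq_iff)
    have zero: "coeff_ext F j (?g j \<beta>) t = 0"
      if "\<beta> \<in> mindices l - ?h ` mindices (Suc (l - k))" for \<beta>
    proof (rule ccontr)
      assume "coeff_ext F j (?g j \<beta>) t \<noteq> 0"
      hence nn: "\<And>i. 0 \<le> ?g j \<beta> i" by (auto simp: coeff_ext_def split: if_splits)
      define \<gamma> where "\<gamma> = (\<lambda>i. nat (?g j \<beta> i))"
      have \<beta>: "\<beta> i = lower_index \<alpha> j i + \<gamma> i" for i
        using nn[of i] low[of i] by (simp add: \<gamma>_def)
      have "(\<Sum>i\<in>UNIV. \<beta> i) = l" using that by (simp add: mindices_def)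
      hence "(k - 1) + (\<Sum>i\<in>UNIV. \<gamma> i) = l"
        using sumlow by (simp add: \<beta> sum.distrib)
      hence "\<gamma> \<in> mindices (Suc (l - k))" using assms by (simp add: mindices_def)
      moreover have "\<beta> = ?h \<gamma>" using \<beta> by auto
      ultimately show False using that by blast
    qed
    have value_at: "coeff_ext F j (?g j (?h \<gamma>)) t = F \<gamma> t $ j"
      if "\<gamma> \<in> mindices (Suc (l - k))" for \<gamma>
    proof -
      have eq: "?g j (?h \<gamma>) = (\<lambda>i. int (\<gamma> i))" using low by (auto simp: fun_eq_iff)
      have "\<gamma> \<noteq> (\<lambda>_. 0)" using that by (auto simp: mindices_def)
      thus ?thesis unfolding eq by (auto simp: coeff_ext_def fun_eq_iff)
    qed
    have "(\<Sum>\<beta>\<in>mindices l. coeff_ext F j (?g j \<beta>) t * v \<beta>) =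
        (\<Sum>\<beta>\<in>?h ` mindices (Suc (l - k)). coeff_ext F j (?g j \<beta>) t * v \<beta>)"
      by (rule sum.mono_neutral_right) (use img zero in auto)
    also have "\<dots> = (\<Sum>\<gamma>\<in>mindices (Suc (l - k)). coeff_ext F j (?g j (?h \<gamma>)) t * v (?h \<gamma>))"
      by (simp add: sum.reindex[OF inj])
    finally show ?thesis using value_at by simp
  qed
  have "(\<Sum>\<beta>\<in>mindices l. carleman_block F k l t \<alpha> \<beta> * v \<beta>) =
      (\<Sum>\<beta>\<in>mindices l. \<Sum>j\<in>UNIV. real (\<alpha> j) * (coeff_ext F j (?g j \<beta>) t * v \<beta>))"
    using \<alpha> by (intro sum.cong refl) (simp add: carleman_block_def sum_distrib_right mult.assoc)
  also have "\<dots> = (\<Sum>j\<in>UNIV. real (\<alpha> j) * (\<Sum>\<beta>\<in>mindices l. coeff_ext F j (?g j \<beta>) t * v \<beta>))"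
    by (subst sum.swap) (simp add: sum_distrib_left)
  also have "\<dots> = carleman_row F t (Suc (l - k)) \<alpha> v"
    unfolding carleman_row_def
  proof (rule sum.cong[OF refl])
    fix j show "real (\<alpha> j) * (\<Sum>\<beta>\<in>mindices l. coeff_ext F j (?g j \<beta>) t * v \<beta>) =
      real (\<alpha> j) * (\<Sum>\<gamma>\<in>mindices (Suc (l - k)). F \<gamma> t $ j * v (\<lambda>i. lower_index \<alpha> j i + \<gamma> i))"
      using column[of j] by (cases "\<alpha> j = 0") auto
  qed
  finally show ?thesis .
qed

lemma carleman_row_diff:
  "carleman_row F t p \<alpha> (\<lambda>\<beta>. u \<beta> - v \<beta>) = carleman_row F t p \<alpha> u - carleman_row F t p \<alpha> v"
  by (simp add: carleman_row_def right_diff_distrib sum_subtractf)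

text \<open>On a vector of monomials the row factors, because \<open>z\<close> to the power \<open>\<alpha> - e\<^sub>j + \<gamma>\<close> is a product. The
  inner sum is the degree \<open>p\<close> part of the field, so this is the degree \<open>p\<close> contribution to the
  derivative of the monomial with index \<open>\<alpha>\<close> along the flow.\<close>

lemma carleman_row_mpower:
  "carleman_row F t p \<alpha> (mpower z) =
     (\<Sum>j\<in>UNIV. real (\<alpha> j) * mpower z (lower_index \<alpha> j) *
        (\<Sum>\<gamma>\<in>mindices p. F \<gamma> t $ j * mpower z \<gamma>))"
  by (simp add: carleman_row_def mpower_add sum_distrib_left mult_ac)

text \<open>A diagonal linear part acts on monomials diagonally: the term \<open>i = j\<close> leads back to
  \<open>\<alpha> - e\<^sub>j + e\<^sub>j = \<alpha>\<close>, and all other terms have zero coefficient.\<close>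

lemma carleman_row_diagonal:
  fixes lam :: "real ^ 'd::finite"
  assumes "\<And>i j. F (mindex_unit i) t $ j = (if i = j then lam $ j else 0)"
  shows "carleman_row F t 1 \<alpha> v = (\<Sum>j\<in>UNIV. real (\<alpha> j) * lam $ j) * v \<alpha>"
proof -
  have "carleman_row F t 1 \<alpha> v = (\<Sum>j\<in>UNIV. real (\<alpha> j) *
      (\<Sum>i\<in>UNIV. (if i = j then lam $ j * v (\<lambda>n. lower_index \<alpha> j n + mindex_unit i n) else 0)))"
    unfolding carleman_row_def mindices_1 sum.reindex[OF inj_mindex_unit] o_def assms
    by (intro sum.cong refl arg_cong2[of _ _ _ _ "(*)"]) simp
  also have "\<dots> = (\<Sum>j\<in>UNIV. real (\<alpha> j) * (lam $ j * v (\<lambda>n. lower_index \<alpha> j n + mindex_unit j n)))"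
    by simp
  also have "\<dots> = (\<Sum>j\<in>UNIV. real (\<alpha> j) * lam $ j * v \<alpha>)"
  proof (rule sum.cong[OF refl])
    fix j show "real (\<alpha> j) * (lam $ j * v (\<lambda>n. lower_index \<alpha> j n + mindex_unit j n)) =
        real (\<alpha> j) * lam $ j * v \<alpha>"
      using lower_index_add_unit[of \<alpha> j] by (cases "\<alpha> j = 0") auto
  qed
  finally show ?thesis by (simp add: sum_distrib_right)
qed

text \<open>The weights \<open>\<alpha> j\<close> add up to the degree \<open>k\<close>, the same factor as in the decay rate \<open>k \<mu>0\<close> of the
  diagonal block. A dimension-dependent factor is avoided because the summands are bounded uniformly
  in \<open>j\<close>.\<close>

lemma abs_weighted_sum_le:
  fixes \<alpha> :: "('d::finite) mindex"
  assumes "\<alpha> \<in> mindices k" and "\<And>j. \<alpha> j > 0 \<Longrightarrow> \<bar>b j\<bar> \<le> B"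
  shows "\<bar>\<Sum>j\<in>UNIV. real (\<alpha> j) * b j\<bar> \<le> real k * B"
proof -
  have "\<bar>\<Sum>j\<in>UNIV. real (\<alpha> j) * b j\<bar> \<le> (\<Sum>j\<in>UNIV. \<bar>real (\<alpha> j) * b j\<bar>)"
    by (rule sum_abs)
  also have "\<dots> \<le> (\<Sum>j\<in>UNIV. real (\<alpha> j) * B)"
  proof (rule sum_mono)
    fix j show "\<bar>real (\<alpha> j) * b j\<bar> \<le> real (\<alpha> j) * B"
      using assms(2)[of j] by (cases "\<alpha> j = 0") (auto simp: abs_mult)
  qed
  also have "\<dots> = real k * B"
    using assms(1) by (simp add: mindices_def flip: sum_distrib_right of_nat_sum)
  finally show ?thesis .
qed

lemma abs_carleman_row_le:
  fixes \<alpha> :: "('d::finite) mindex"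
  assumes \<alpha>: "\<alpha> \<in> mindices k"
    and coeff: "\<And>j. (\<Sum>\<gamma>\<in>mindices p. \<bar>F \<gamma> t $ j\<bar>) \<le> S"
    and v: "\<And>\<beta>. \<beta> \<in> mindices (k - 1 + p) \<Longrightarrow> \<bar>v \<beta>\<bar> \<le> V" and "V \<ge> 0"
  shows "\<bar>carleman_row F t p \<alpha> v\<bar> \<le> real k * (S * V)"
  unfolding carleman_row_def
proof (rule abs_weighted_sum_le[OF \<alpha>])
  fix j assume j: "\<alpha> j > 0"
  have "\<bar>\<Sum>\<gamma>\<in>mindices p. F \<gamma> t $ j * v (\<lambda>i. lower_index \<alpha> j i + \<gamma> i)\<bar>
      \<le> (\<Sum>\<gamma>\<in>mindices p. \<bar>F \<gamma> t $ j * v (\<lambda>i. lower_index \<alpha> j i + \<gamma> i)\<bar>)" by (rule sum_abs)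
  also have "\<dots> \<le> (\<Sum>\<gamma>\<in>mindices p. \<bar>F \<gamma> t $ j\<bar> * V)"
    unfolding abs_mult
  proof (intro sum_mono mult_left_mono v)
    fix \<gamma> :: "'d mindex" assume "\<gamma> \<in> mindices p"
    with lower_index_in_mindices[OF \<alpha> j]
    show "(\<lambda>i. lower_index \<alpha> j i + \<gamma> i) \<in> mindices (k - 1 + p)"
      by (simp add: mindices_def sum.distrib)
  qed simp
  also have "\<dots> \<le> S * V"
    using coeff[of j] \<open>V \<ge> 0\<close> by (simp add: mult_right_mono flip: sum_distrib_right)
  finally show "\<bar>\<Sum>\<gamma>\<in>mindices p. F \<gamma> t $ j * v (\<lambda>i. lower_index \<alpha> j i + \<gamma> i)\<bar> \<le> S * V" .
qed

section \<open>A barrier for damped scalar equations\<close>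

text \<open>The forcing \<open>g\<close> is an arbitrary function, so variation of constants, which would need \<open>g\<close> to be
  integrable, is replaced by a monotonicity argument: the integrating factor makes
  \<open>(u - C) e\<^sup>d\<^sup>t\<close> nonincreasing.\<close>

lemma linear_decay_upper_barrier:
  fixes u g :: "real \<Rightarrow> real"
  assumes "a \<le> b" and cont: "continuous_on {a..b} u"
    and deriv: "\<And>t. a < t \<Longrightarrow> t < b \<Longrightarrow> (u has_real_derivative - d * u t + g t) (at t)"
    and forcing: "\<And>t. a < t \<Longrightarrow> t < b \<Longrightarrow> g t \<le> d * C" and "u a \<le> C"
  shows "u b \<le> C"
proof -
  have "(u b - C) * exp (d * b) \<le> (u a - C) * exp (d * a)"
  proof (rule DERIV_nonpos_imp_decreasing_open[OF \<open>a \<le> b\<close>])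
    show "continuous_on {a..b} (\<lambda>t. (u t - C) * exp (d * t))"
      by (intro continuous_intros cont)
    fix t assume t: "a < t" "t < b"
    have "((\<lambda>t. (u t - C) * exp (d * t)) has_real_derivative (g t - d * C) * exp (d * t)) (at t)"
      using deriv[OF t] by (auto intro!: derivative_eq_intros simp: algebra_simps)
    moreover have "(g t - d * C) * exp (d * t) \<le> 0"
      using forcing[OF t] by (simp add: mult_nonpos_nonneg)
    ultimately show "\<exists>y. ((\<lambda>t. (u t - C) * exp (d * t)) has_real_derivative y) (at t) \<and> y \<le> 0"
      by blast
  qed
  also have "\<dots> \<le> 0" using \<open>u a \<le> C\<close> by (simp add: mult_nonpos_nonneg)
  finally show ?thesis by (simp add: mult_le_0_iff)
qed

lemma linear_decay_barrier:
  fixes u g :: "real \<Rightarrow> real"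
  assumes "a \<le> b" and cont: "continuous_on {a..b} u"
    and deriv: "\<And>t. a < t \<Longrightarrow> t < b \<Longrightarrow> (u has_real_derivative - d * u t + g t) (at t)"
    and forcing: "\<And>t. a < t \<Longrightarrow> t < b \<Longrightarrow> \<bar>g t\<bar> \<le> d * C" and "\<bar>u a\<bar> \<le> C"
  shows "\<bar>u b\<bar> \<le> C"
proof -
  have "u b \<le> C"
    using assms by (intro linear_decay_upper_barrier[of a b u d g C]) (auto simp: abs_le_iff)
  moreover have "- u b \<le> C"
  proof (rule linear_decay_upper_barrier[of a b "\<lambda>t. - u t" d "\<lambda>t. - g t" C])
    fix t assume t: "a < t" "t < b"
    show "((\<lambda>t. - u t) has_real_derivative - d * - u t + - g t) (at t)"
      using deriv[OF t] by (auto intro!: derivative_eq_intros)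
    show "- g t \<le> d * C" using forcing[OF t] by linarith
  qed (use assms in \<open>auto intro: continuous_intros\<close>)
  ultimately show ?thesis by linarith
qed

section \<open>Truncation of Maclaurin series\<close>

text \<open>Grouping the absolutely convergent multi-index series by degree turns it into an ordinary series
  whose \<open>p\<close>-th term is at most \<open>D (m / R)\<^sup>p\<close>; the tail is then dominated by a geometric series.\<close>

lemma maclaurin_truncation_error:
  fixes z v :: "real ^ 'd::finite"
  assumes series: "((\<lambda>\<alpha>. mpower z \<alpha> *\<^sub>R F \<alpha> t) has_sum v) (UNIV - {\<lambda>_. 0})"
    and z: "\<And>i. \<bar>z $ i\<bar> \<le> m" and "0 \<le> m" "m < R"
    and coeff: "\<And>p. p \<ge> 1 \<Longrightarrow> (\<Sum>\<gamma>\<in>mindices p. \<bar>F \<gamma> t $ j\<bar>) \<le> D / R ^ p"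
  shows "\<bar>v $ j - (\<Sum>p=1..P. \<Sum>\<gamma>\<in>mindices p. F \<gamma> t $ j * mpower z \<gamma>)\<bar>
           \<le> D * (m / R) ^ Suc P / (1 - m / R)"
proof -
  \<comment> \<open>The homogeneous parts; \<open>h 0 = 0\<close> because the constant term is excluded from the series.\<close>
  define h where "h p = (if p = 0 then 0 else \<Sum>\<gamma>\<in>mindices p. F \<gamma> t $ j * mpower z \<gamma>)" for p
  define \<rho> where "\<rho> = m / R"
  have \<rho>: "0 \<le> \<rho>" "\<rho> < 1" using assms by (simp_all add: \<rho>_def)
  have "((\<lambda>\<alpha>. (mpower z \<alpha> *\<^sub>R F \<alpha> t) $ j) has_sum v $ j) (UNIV - {\<lambda>_. 0})"
    using has_sum_bounded_linear[OF bounded_linear_vec_nth series] by (simp add: o_def)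
  hence comp: "((\<lambda>\<alpha>. F \<alpha> t $ j * mpower z \<alpha>) has_sum v $ j) (UNIV - {\<lambda>_. 0})"
    by (simp add: mult.commute)
  have by_degree: "bij_betw snd (Sigma {1..} (mindices :: nat \<Rightarrow> 'd mindex set)) (UNIV - {\<lambda>_. 0})"
    unfolding bij_betw_def
  proof
    show "inj_on snd (Sigma {1..} (mindices :: nat \<Rightarrow> 'd mindex set))"
      by (auto simp: inj_on_def mindices_def)
    show "snd ` Sigma {1..} mindices = UNIV - {\<lambda>_::'d. 0::nat}"
    proof (intro equalityI subsetI)
      fix \<alpha> :: "'d mindex" assume "\<alpha> \<in> UNIV - {\<lambda>_. 0}"
      hence "sum \<alpha> UNIV \<ge> 1" by (auto simp: fun_eq_iff Suc_le_eq intro: gr0I)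
      hence "(sum \<alpha> UNIV, \<alpha>) \<in> Sigma {1..} mindices" by (simp add: mindices_def)
      thus "\<alpha> \<in> snd ` Sigma {1..} mindices" by force
    qed (auto simp: mindices_def)
  qed
  have "((\<lambda>x. F (snd x) t $ j * mpower z (snd x)) has_sum v $ j) (Sigma {1..} mindices)"
    using comp has_sum_reindex_bij_betw[OF by_degree, of "\<lambda>\<alpha>. F \<alpha> t $ j * mpower z \<alpha>"] by simp
  hence "(h has_sum v $ j) {1..}"
    by (rule has_sum_SigmaD) (simp add: h_def has_sum_finite)
  also have "(h has_sum v $ j) {1..} \<longleftrightarrow> (h has_sum v $ j) UNIV"
    by (rule has_sum_cong_neutral) (auto simp: h_def)
  finally have "h sums (v $ j)" by (rule has_sum_imp_sums)
  hence tail: "(\<lambda>i. h (i + Suc P)) sums (v $ j - (\<Sum>i<Suc P. h i))"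
    by (rule sums_split_initial_segment)
  have geom: "(\<lambda>i. (D * \<rho> ^ Suc P) * \<rho> ^ i) sums ((D * \<rho> ^ Suc P) * (1 / (1 - \<rho>)))"
    using \<rho> by (intro sums_mult geometric_sums) auto
  have term_le: "norm (h (i + Suc P)) \<le> (D * \<rho> ^ Suc P) * \<rho> ^ i" for i
  proof -
    let ?p = "i + Suc P"
    have "\<bar>h ?p\<bar> \<le> (\<Sum>\<gamma>\<in>mindices ?p. \<bar>F \<gamma> t $ j * mpower z \<gamma>\<bar>)"
      by (simp add: h_def sum_abs del: add_Suc_right)
    also have "\<dots> \<le> (\<Sum>\<gamma>\<in>mindices ?p. \<bar>F \<gamma> t $ j\<bar> * m ^ ?p)"
      unfolding abs_mult by (intro sum_mono mult_left_mono abs_mpower_le z) auto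
    also have "\<dots> \<le> D / R ^ ?p * m ^ ?p"
      unfolding sum_distrib_right[symmetric] using \<open>0 \<le> m\<close>
      by (intro mult_right_mono coeff) auto
    also have "\<dots> = (D * \<rho> ^ Suc P) * \<rho> ^ i"
      by (simp add: \<rho>_def power_divide power_add mult_ac)
    finally show ?thesis by simp
  qed
  have "norm (v $ j - (\<Sum>i<Suc P. h i)) \<le> (D * \<rho> ^ Suc P) * (1 / (1 - \<rho>))"
    by (rule norm_sums_le[OF tail geom term_le])
  moreover have "(\<Sum>i<Suc P. h i) = (\<Sum>p=1..P. \<Sum>\<gamma>\<in>mindices p. F \<gamma> t $ j * mpower z \<gamma>)"
  proof -
    have "(\<Sum>i<Suc P. h i) = (\<Sum>p=1..P. h p)"
      by (rule sum.mono_neutral_right) (auto simp: h_def not_le)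
    thus ?thesis by (simp add: h_def)
  qed
  ultimately show ?thesis by (simp add: \<rho>_def)
qed

section \<open>The geometric supersolution\<close>

text \<open>The \<open>i\<close>-th summand is \<open>\<rho>\<^sup>n\<^sup>+\<^sup>1 (1 + a)\<^sup>n\<^sup>+\<^sup>1\<^sup>-\<^sup>i\<close>, so the sum is geometric with ratio \<open>1 + a\<close>, and the
  factor \<open>a\<close> cancels the denominator of its closed form.\<close>

lemma geometric_majorant:
  fixes a \<rho> q :: real
  assumes "q = (1 + a) * \<rho>"
  shows "a * (\<Sum>i=1..n. \<rho> ^ i * q ^ (Suc n - i)) = q ^ Suc n - (1 + a) * \<rho> ^ Suc n"
proof (induction n)
  case 0
  thus ?case by (simp add: assms)
next
  case (Suc n)
  have "(\<Sum>i=1..n. \<rho> ^ i * q ^ (Suc (Suc n) - i)) = q * (\<Sum>i=1..n. \<rho> ^ i * q ^ (Suc n - i))"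
    unfolding sum_distrib_left by (intro sum.cong refl) (simp add: Suc_diff_le)
  hence "a * (\<Sum>i=1..Suc n. \<rho> ^ i * q ^ (Suc (Suc n) - i)) =
      q * (a * (\<Sum>i=1..n. \<rho> ^ i * q ^ (Suc n - i))) + a * (\<rho> ^ Suc n * q)"
    by (simp add: algebra_simps)
  also have "\<dots> = q ^ Suc (Suc n) - q * \<rho> ^ Suc n"
    unfolding Suc.IH by (simp add: algebra_simps)
  finally show ?case by (simp add: assms)
qed

text \<open>The inequality for \<open>C\<^sub>k = M\<^sup>k q\<^sup>N\<^sup>+\<^sup>1\<^sup>-\<^sup>k\<close>, divided by \<open>\<mu>0 M\<^sup>k\<close>, with \<open>n = N - k\<close> and
  \<open>l = k + i\<close>: the sum is the coupling to the blocks of degree \<open>k < l \<le> N\<close>, the fraction is the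
  tail of degree above \<open>N\<close>. The condition \<open>q \<le> 1\<close> is equivalent to \<open>a / (1 - \<rho>) \<le> 1 + a\<close>, which
  lets the slack left by the geometric sum absorb the tail.\<close>

lemma majorant_is_supersolution:
  fixes a \<rho> q :: real
  assumes q: "q = (1 + a) * \<rho>" and "q \<le> 1" "0 \<le> \<rho>" "\<rho> < 1"
  shows "a * (\<Sum>i=1..n. \<rho> ^ i * q ^ (Suc n - i)) + a * \<rho> ^ Suc n / (1 - \<rho>) \<le> q ^ Suc n"
proof -
  have "a / (1 - \<rho>) \<le> 1 + a"
    using assms by (simp add: field_simps)
  hence "a / (1 - \<rho>) * \<rho> ^ Suc n \<le> (1 + a) * \<rho> ^ Suc n"
    using \<open>0 \<le> \<rho>\<close> by (intro mult_right_mono) auto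
  thus ?thesis unfolding geometric_majorant[OF q] by simp
qed

section \<open>Confinement of the trajectory\<close>

lemma infnorm_le_cart:
  fixes z :: "real ^ 'd::finite"
  assumes "\<And>i. \<bar>z $ i\<bar> \<le> b"
  shows "infnorm z \<le> b"
  unfolding infnorm_cart by (rule cSup_least) (use assms in auto)

text \<open>Column \<open>i\<close> of the linear part is \<open>F (mindex_unit i) t\<close>, which \<open>jacobian\<close> lists as rows; for a
  diagonal matrix both readings agree.\<close>

locale dissipative_analytic_ode =
  fixes f :: "real \<Rightarrow> real ^ 'd::finite \<Rightarrow> real ^ 'd"
    and F :: "'d mindex \<Rightarrow> real \<Rightarrow> real ^ 'd"
    and D0 R \<mu>0 t0 :: real
    and lam :: "real ^ 'd"
    and x :: "real \<Rightarrow> real ^ 'd"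
  assumes D0_pos: "D0 > 0" and R_pos: "R > 0" and \<mu>0_pos: "\<mu>0 > 0"
    and maclaurin: "\<And>t z. t \<ge> t0 \<Longrightarrow> infnorm z < R \<Longrightarrow>
      ((\<lambda>\<alpha>. mpower z \<alpha> *\<^sub>R F \<alpha> t) has_sum f t z) (UNIV - {\<lambda>_. 0})"
    and coeff_bound: "\<And>t k. t \<ge> t0 \<Longrightarrow> k \<ge> 1 \<Longrightarrow>
      (\<Sum>j\<in>UNIV. \<Sum>\<alpha>\<in>mindices k. \<bar>F \<alpha> t $ j\<bar>) \<le> D0 / R ^ k"
    and jacobian: "\<And>t. t \<ge> t0 \<Longrightarrow>
      (\<chi> i. F (mindex_unit i) t) = (\<chi> i j. if i = j then lam $ i else 0)"
    and lam_le: "\<And>j. lam $ j \<le> - \<mu>0"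
    and ode: "\<And>t. t \<ge> t0 \<Longrightarrow> (x has_vector_derivative f t (x t)) (at t within {t0..})"
begin

lemma linear_coeff:
  assumes "t \<ge> t0"
  shows "F (mindex_unit i) t $ j = (if i = j then lam $ j else 0)"
  using jacobian[OF assms] by (auto simp: vec_eq_iff)

lemma coeff_bound_component:
  assumes "t \<ge> t0" "k \<ge> 1"
  shows "(\<Sum>\<alpha>\<in>mindices k. \<bar>F \<alpha> t $ j\<bar>) \<le> D0 / R ^ k"
proof -
  have "(\<Sum>\<alpha>\<in>mindices k. \<bar>F \<alpha> t $ j\<bar>) \<le> (\<Sum>j\<in>UNIV. \<Sum>\<alpha>\<in>mindices k. \<bar>F \<alpha> t $ j\<bar>)"
    by (rule member_le_sum) (auto intro: sum_nonneg)
  thus ?thesis using coeff_bound[OF assms] by linarith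
qed

lemma truncation_error:
  assumes "t \<ge> t0" and z: "\<And>i. \<bar>z $ i\<bar> \<le> m" and "0 \<le> m" "m < R"
  shows "\<bar>f t z $ j - (\<Sum>p=1..P. \<Sum>\<gamma>\<in>mindices p. F \<gamma> t $ j * mpower z \<gamma>)\<bar>
           \<le> D0 * (m / R) ^ Suc P / (1 - m / R)"
proof (rule maclaurin_truncation_error)
  show "((\<lambda>\<alpha>. mpower z \<alpha> *\<^sub>R F \<alpha> t) has_sum f t z) (UNIV - {\<lambda>_. 0})"
    using infnorm_le_cart[OF z] assms by (intro maclaurin) auto
  show "(\<Sum>\<gamma>\<in>mindices p. \<bar>F \<gamma> t $ j\<bar>) \<le> D0 / R ^ p" if "p \<ge> 1" for p
    using coeff_bound_component[OF \<open>t \<ge> t0\<close> that] .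
qed (fact assms)+

lemma continuous_on_trajectory: "continuous_on {t0..} x"
  using ode by (intro continuous_on_vector_derivative[of _ x "\<lambda>t. f t (x t)"]) simp

lemma component_derivative:
  assumes "t > t0"
  shows "((\<lambda>s. x s $ j) has_real_derivative f t (x t) $ j) (at t)"
proof -
  have "(x has_vector_derivative f t (x t)) (at t)"
    using ode[of t] assms at_within_interior[of t "{t0..}"] by simp
  thus ?thesis
    unfolding has_real_derivative_iff_has_vector_derivative
    by (rule bounded_linear.has_vector_derivative[OF bounded_linear_vec_nth])
qed

lemma linear_part_error:
  assumes "t \<ge> t0" "\<And>i. \<bar>z $ i\<bar> \<le> m" "0 \<le> m" "m < R"
  shows "\<bar>f t z $ j - lam $ j * z $ j\<bar> \<le> D0 * (m / R)\<^sup>2 / (1 - m / R)"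
proof -
  have "(\<Sum>p=1..1. \<Sum>\<gamma>\<in>mindices p. F \<gamma> t $ j * mpower z \<gamma>) =
      (\<Sum>i\<in>UNIV. F (mindex_unit i) t $ j * z $ i)"
    unfolding atLeastAtMost_singleton
    by (simp only: sum.insert finite.emptyI empty_iff not_False_eq_True sum.empty add_0_right
          mindices_1 sum.reindex[OF inj_mindex_unit] o_def mpower_unit)
  also have "\<dots> = (\<Sum>i\<in>UNIV. if i = j then lam $ j * z $ i else 0)"
    by (rule sum.cong) (simp_all add: linear_coeff[OF assms(1)])
  also have "\<dots> = lam $ j * z $ j" by simp
  finally have degree_1: "(\<Sum>p=1..1. \<Sum>\<gamma>\<in>mindices p. F \<gamma> t $ j * mpower z \<gamma>) = lam $ j * z $ j" .
  show ?thesis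
    using truncation_error[OF assms, of j 1] unfolding degree_1 Suc_1 .
qed

lemma below_critical_radius:
  assumes "m < R\<^sup>2 * \<mu>0 / (D0 + R * \<mu>0)"
  shows "(D0 + R * \<mu>0) * m < R\<^sup>2 * \<mu>0" "m < R"
proof -
  have pos: "D0 + R * \<mu>0 > 0" using D0_pos R_pos \<mu>0_pos by (simp add: add_pos_pos)
  show *: "(D0 + R * \<mu>0) * m < R\<^sup>2 * \<mu>0"
    using assms pos by (simp add: pos_less_divide_eq mult.commute)
  have "(D0 + R * \<mu>0) * R > R\<^sup>2 * \<mu>0"
    using D0_pos R_pos by (simp add: power2_eq_square algebra_simps)
  with * have "(D0 + R * \<mu>0) * m < (D0 + R * \<mu>0) * R" by linarith
  thus "m < R" using pos by simp
qed

text \<open>At the first time \<open>T\<close> at which the sup-norm reaches \<open>m\<close>, the nonlinear part has so far been bounded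
  by some \<open>G < \<mu>0 m\<close>. Each component is a scalar equation with damping at least \<open>\<mu>0\<close>, so it is at
  most the maximum of its initial value and \<open>G / \<mu>0\<close>, hence strictly below \<open>m\<close> at \<open>T\<close>.\<close>

lemma infnorm_stays_below:
  assumes start: "infnorm (x t0) < m" and m: "m < R\<^sup>2 * \<mu>0 / (D0 + R * \<mu>0)" and "t \<ge> t0"
  shows "infnorm (x t) < m"
proof (rule ccontr)
  assume "\<not> infnorm (x t) < m"
  define S where "S = {s \<in> {t0..t}. infnorm (x s) \<in> {m..}}"
  have S_ne: "S \<noteq> {}" using \<open>\<not> infnorm (x t) < m\<close> \<open>t \<ge> t0\<close> by (auto simp: S_def)
  have "continuous_on {t0..t} (\<lambda>s. infnorm (x s))"
    by (rule continuous_on_subset[OF continuous_on_infnorm[OF continuous_on_trajectory]]) auto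
  hence "closed S"
    unfolding S_def using continuous_closed_preimage[of "{t0..t}" "\<lambda>s. infnorm (x s)" "{m..}"]
    by (simp add: vimage_def Int_def)
  moreover have bdd: "bdd_below S" by (auto simp: S_def bdd_below_def)
  ultimately have T: "Inf S \<in> S" using S_ne closed_contains_Inf by blast
  define T where "T = Inf S"
  have T_ge: "T \<ge> t0" "infnorm (x T) \<ge> m" "T \<le> t" using T by (auto simp: S_def T_def)
  have before: "infnorm (x s) < m" if "t0 \<le> s" "s < T" for s
  proof (rule ccontr)
    assume "\<not> infnorm (x s) < m"
    hence "s \<in> S" using that T_ge by (auto simp: S_def)
    thus False using cInf_lower[OF _ bdd, of s] that by (simp add: T_def)
  qed
  have m_pos: "m > 0" using start infnorm_pos_le[of "x t0"] by linarith
  note crit = below_critical_radius[OF m]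
  define G where "G = D0 * (m / R)\<^sup>2 / (1 - m / R)"
  have "D0 * m < \<mu>0 * R * (R - m)" using crit by (simp add: algebra_simps power2_eq_square)
  hence "m * (D0 * m) < m * (\<mu>0 * R * (R - m))" using m_pos by simp
  moreover have "G = m * (D0 * m) / (R * (R - m))"
    using R_pos crit by (simp add: G_def field_simps power2_eq_square)
  ultimately have G: "G < \<mu>0 * m"
    using R_pos crit by (simp add: pos_divide_less_eq mult_ac)
  define C where "C = max (infnorm (x t0)) (G / \<mu>0)"
  have "C < m" using start G \<mu>0_pos by (simp add: C_def pos_divide_less_eq mult.commute)
  have C_nonneg: "C \<ge> 0" using infnorm_pos_le[of "x t0"] by (simp add: C_def)
  have "\<bar>x T $ j\<bar> \<le> C" for j
  proof (rule linear_decay_barrier[of t0 T "\<lambda>s. x s $ j" "- lam $ j" "\<lambda>s. f s (x s) $ j - lam $ j * x s $ j"])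
    show "continuous_on {t0..T} (\<lambda>s. x s $ j)"
      by (rule continuous_on_subset[OF continuous_on_component[OF continuous_on_trajectory]]) auto
    show "\<bar>x t0 $ j\<bar> \<le> C"
      using component_le_infnorm_cart[of "x t0" j] by (simp add: C_def)
    fix s assume s: "t0 < s" "s < T"
    show "((\<lambda>s. x s $ j) has_real_derivative
        - (- lam $ j) * x s $ j + (f s (x s) $ j - lam $ j * x s $ j)) (at s)"
      using component_derivative[OF s(1)] by simp
    have "\<bar>x s $ i\<bar> \<le> m" for i
      using before[of s] s component_le_infnorm_cart[of "x s" i] by linarith
    hence "\<bar>f s (x s) $ j - lam $ j * x s $ j\<bar> \<le> G"
      unfolding G_def using s m_pos crit by (intro linear_part_error) auto
    also have "G \<le> \<mu>0 * C" using \<mu>0_pos by (simp add: C_def max_def field_simps)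
    also have "\<dots> \<le> - lam $ j * C"
      using lam_le[of j] C_nonneg by (intro mult_right_mono) auto
    finally show "\<bar>f s (x s) $ j - lam $ j * x s $ j\<bar> \<le> - lam $ j * C" .
  qed (use T_ge in auto)
  hence "infnorm (x T) \<le> C" by (rule infnorm_le_cart)
  thus False using \<open>C < m\<close> T_ge by linarith
qed

text \<open>The strict barrier is applied at every level \<open>m\<close> between \<open>M\<close> and the critical radius; letting
  \<open>m\<close> decrease to \<open>M\<close> covers the case of equality at the initial time.\<close>

lemma infnorm_trajectory_le:
  assumes "infnorm (x t0) \<le> M" "M < R\<^sup>2 * \<mu>0 / (D0 + R * \<mu>0)" "t \<ge> t0"
  shows "infnorm (x t) \<le> M"
proof (rule dense_ge_bounded[OF assms(2)])
  fix m assume "M < m" "m < R\<^sup>2 * \<mu>0 / (D0 + R * \<mu>0)"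
  thus "infnorm (x t) \<le> m" using infnorm_stays_below[of m t] assms by linarith
qed

section \<open>The error of the finite section\<close>

text \<open>The monomials of an exact solution satisfy the Carleman system up to the blocks of high degree: the
  first sum is the derivative of the monomial with index \<open>\<alpha>\<close> along the field, and truncating each
  field component after degree \<open>P\<close> leaves the first \<open>P\<close> blocks.\<close>

lemma monomial_truncation_error:
  fixes z :: "real ^ 'd"
  assumes \<alpha>: "\<alpha> \<in> mindices k" and "t \<ge> t0" and z: "\<And>i. \<bar>z $ i\<bar> \<le> m" and "0 \<le> m" "m < R"
  shows "\<bar>(\<Sum>j\<in>UNIV. real (\<alpha> j) * mpower z (lower_index \<alpha> j) * f t z $ j)
            - (\<Sum>p=1..P. carleman_row F t p \<alpha> (mpower z))\<bar>
         \<le> real k * (m ^ (k - 1) * (D0 * (m / R) ^ Suc P / (1 - m / R)))"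
proof -
  have "(\<Sum>p=1..P. carleman_row F t p \<alpha> (mpower z)) =
      (\<Sum>j\<in>UNIV. real (\<alpha> j) * mpower z (lower_index \<alpha> j) *
         (\<Sum>p=1..P. \<Sum>\<gamma>\<in>mindices p. F \<gamma> t $ j * mpower z \<gamma>))"
    unfolding carleman_row_mpower by (subst sum.swap) (simp add: sum_distrib_left)
  hence "(\<Sum>j\<in>UNIV. real (\<alpha> j) * mpower z (lower_index \<alpha> j) * f t z $ j)
        - (\<Sum>p=1..P. carleman_row F t p \<alpha> (mpower z)) =
      (\<Sum>j\<in>UNIV. real (\<alpha> j) * (mpower z (lower_index \<alpha> j) *
         (f t z $ j - (\<Sum>p=1..P. \<Sum>\<gamma>\<in>mindices p. F \<gamma> t $ j * mpower z \<gamma>))))"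
    by (simp add: right_diff_distrib mult.assoc flip: sum_subtractf)
  also have "\<bar>\<dots>\<bar> \<le> real k * (m ^ (k - 1) * (D0 * (m / R) ^ Suc P / (1 - m / R)))"
  proof (rule abs_weighted_sum_le[OF \<alpha>])
    fix j assume "\<alpha> j > 0"
    thus "\<bar>mpower z (lower_index \<alpha> j) *
         (f t z $ j - (\<Sum>p=1..P. \<Sum>\<gamma>\<in>mindices p. F \<gamma> t $ j * mpower z \<gamma>))\<bar>
        \<le> m ^ (k - 1) * (D0 * (m / R) ^ Suc P / (1 - m / R))"
      unfolding abs_mult using assms
      by (intro mult_mono truncation_error abs_mpower_le lower_index_in_mindices) auto
  qed
  finally show ?thesis .
qed

text \<open>Descending induction on \<open>k\<close>. The error with index \<open>\<alpha>\<close> obeys \<open>e' = - d e + g\<close> with \<open>d \<ge> k \<mu>0\<close>,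
  where \<open>g\<close> collects the coupling to errors of higher degree, bounded by the induction hypothesis,
  and the truncated tail. The supersolution property gives \<open>\<bar>g\<bar> \<le> k \<mu>0 M\<^sup>k q\<^sup>N\<^sup>+\<^sup>1\<^sup>-\<^sup>k\<close>, and the
  error starts at zero, so the scalar barrier applies at the level \<open>M\<^sup>k q\<^sup>N\<^sup>+\<^sup>1\<^sup>-\<^sup>k\<close>.\<close>

lemma carleman_error_le:
  fixes M :: real
  defines "q \<equiv> (D0 + R * \<mu>0) * M / (R\<^sup>2 * \<mu>0)"
  assumes fin_sec: "finite_section_solution F t0 (x t0) N y"
    and start: "infnorm (x t0) \<le> M" and M: "M < R\<^sup>2 * \<mu>0 / (D0 + R * \<mu>0)"
    and "1 \<le> k" "k \<le> N" "\<alpha> \<in> mindices k" "t \<ge> t0"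
  shows "\<bar>mpower (x t) \<alpha> - y k t \<alpha>\<bar> \<le> M ^ k * q ^ (Suc N - k)"
  using assms(5-)
proof (induction "N - k" arbitrary: k \<alpha> t rule: less_induct)
  case less
  note k = \<open>1 \<le> k\<close> \<open>k \<le> N\<close> and \<alpha> = \<open>\<alpha> \<in> mindices k\<close>
  define \<rho> where "\<rho> = M / R"
  define a where "a = D0 / (\<mu>0 * R)"
  define n where "n = N - k"
  have M_nonneg: "M \<ge> 0" using start infnorm_pos_le[of "x t0"] by linarith
  note crit = below_critical_radius[OF M]
  have \<rho>: "0 \<le> \<rho>" "\<rho> < 1" using M_nonneg crit R_pos by (simp_all add: \<rho>_def)
  have q: "q = (1 + a) * \<rho>"
    using R_pos \<mu>0_pos by (simp add: q_def a_def \<rho>_def field_simps power2_eq_square)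
  have q_le: "q \<le> 1" using crit R_pos \<mu>0_pos by (simp add: q_def)
  have q_nonneg: "q \<ge> 0" using D0_pos R_pos \<mu>0_pos M_nonneg by (simp add: q_def)
  have x_le: "\<bar>x s $ i\<bar> \<le> M" if "s \<ge> t0" for s i
    using infnorm_trajectory_le[OF start M that] component_le_infnorm_cart[of "x s" i] by linarith

  define e where "e l s \<beta> = mpower (x s) \<beta> - y l s \<beta>" for l s \<beta>
  define W where "W s = (\<Sum>j\<in>UNIV. real (\<alpha> j) * mpower (x s) (lower_index \<alpha> j) * f s (x s) $ j)" for s
  define g where "g s = (W s - (\<Sum>p=1..Suc n. carleman_row F s p \<alpha> (mpower (x s))))
      + (\<Sum>l=Suc k..N. carleman_row F s (Suc (l - k)) \<alpha> (e l s))" for s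
  define d where "d = - (\<Sum>j\<in>UNIV. real (\<alpha> j) * lam $ j)"

  have deriv_y: "((\<lambda>s. y k s \<alpha>) has_real_derivative
      (\<Sum>l=k..N. \<Sum>\<beta>\<in>mindices l. carleman_block F k l s \<alpha> \<beta> * y l s \<beta>)) (at s within {t0..})"
    if "s \<ge> t0" for s
  proof -
    have "k \<in> {1..N}" using k by simp
    from bspec[OF bspec[OF fin_sec[unfolded finite_section_solution_def] this] \<alpha>] that
    show ?thesis by blast
  qed

  have "\<bar>e k t \<alpha>\<bar> \<le> M ^ k * q ^ (Suc N - k)"
  proof (rule linear_decay_barrier[of t0 t "\<lambda>s. e k s \<alpha>" d g])
    have cont_y: "continuous_on {t0..} (\<lambda>s. y k s \<alpha>)"
      by (rule DERIV_continuous_on[OF deriv_y]) simp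
    have "continuous_on {t0..} (\<lambda>s. e k s \<alpha>)"
      unfolding e_def mpower_def by (intro continuous_intros cont_y continuous_on_trajectory)
    thus "continuous_on {t0..t} (\<lambda>s. e k s \<alpha>)" by (rule continuous_on_subset) auto
    have "e k t0 \<alpha> = 0"
      using fin_sec k \<alpha> by (simp add: e_def finite_section_solution_def)
    thus "\<bar>e k t0 \<alpha>\<bar> \<le> M ^ k * q ^ (Suc N - k)" using M_nonneg q_nonneg by simp
    show "t0 \<le> t" by fact
  next
    fix s assume s: "t0 < s" "s < t"
    hence s0: "s \<ge> t0" by simp
    have "((\<lambda>s. y k s \<alpha>) has_real_derivative
        (\<Sum>l=k..N. \<Sum>\<beta>\<in>mindices l. carleman_block F k l s \<alpha> \<beta> * y l s \<beta>)) (at s)"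
      using deriv_y[OF s0] at_within_interior[of s "{t0..}"] s by simp
    also have "(\<Sum>l=k..N. \<Sum>\<beta>\<in>mindices l. carleman_block F k l s \<alpha> \<beta> * y l s \<beta>)
        = (\<Sum>l=k..N. carleman_row F s (Suc (l - k)) \<alpha> (y l s))"
      using k \<alpha> by (intro sum.cong refl carleman_block_eq_row) auto
    finally have "((\<lambda>s. e k s \<alpha>) has_real_derivative
        W s - (\<Sum>l=k..N. carleman_row F s (Suc (l - k)) \<alpha> (y l s))) (at s)"
      unfolding e_def W_def
      by (intro DERIV_diff has_real_derivative_mpower component_derivative s)
    also have "W s - (\<Sum>l=k..N. carleman_row F s (Suc (l - k)) \<alpha> (y l s)) = - d * e k s \<alpha> + g s"
    proof -
      have "(\<Sum>p=1..Suc n. carleman_row F s p \<alpha> (mpower (x s))) =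
          (\<Sum>l=k..N. carleman_row F s (Suc (l - k)) \<alpha> (mpower (x s)))"
        using k by (intro sum.reindex_bij_witness[of _ "\<lambda>l. Suc (l - k)" "\<lambda>p. p + k - 1"])
          (auto simp: n_def)
      hence "(\<Sum>p=1..Suc n. carleman_row F s p \<alpha> (mpower (x s)))
          - (\<Sum>l=k..N. carleman_row F s (Suc (l - k)) \<alpha> (y l s))
          = (\<Sum>l=k..N. carleman_row F s (Suc (l - k)) \<alpha> (e l s))"
        unfolding e_def by (simp add: carleman_row_diff sum_subtractf)
      also have "\<dots> = carleman_row F s 1 \<alpha> (e k s)
          + (\<Sum>l=Suc k..N. carleman_row F s (Suc (l - k)) \<alpha> (e l s))"
        using k by (simp add: sum.atLeast_Suc_atMost)
      also have "carleman_row F s 1 \<alpha> (e k s) = - d * e k s \<alpha>"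
        using carleman_row_diagonal[of F s lam \<alpha> "e k s", OF linear_coeff[OF s0]]
        by (simp add: d_def)
      finally show ?thesis unfolding g_def by linarith
    qed
    finally show "((\<lambda>s. e k s \<alpha>) has_real_derivative - d * e k s \<alpha> + g s) (at s)" .

    have coupling: "\<bar>carleman_row F s (Suc (l - k)) \<alpha> (e l s)\<bar>
        \<le> real k * (D0 / R ^ Suc (l - k) * (M ^ l * q ^ (Suc N - l)))" if "l \<in> {Suc k..N}" for l
    proof (rule abs_carleman_row_le[OF \<alpha>])
      fix \<beta> :: "'d mindex" assume "\<beta> \<in> mindices (k - 1 + Suc (l - k))"
      moreover have "k - 1 + Suc (l - k) = l" using that k by auto
      ultimately show "\<bar>e l s \<beta>\<bar> \<le> M ^ l * q ^ (Suc N - l)"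
        unfolding e_def using that k s0 by (intro less.hyps) auto
    next
      show "(\<Sum>\<gamma>\<in>mindices (Suc (l - k)). \<bar>F \<gamma> s $ j\<bar>) \<le> D0 / R ^ Suc (l - k)" for j
        by (rule coeff_bound_component[OF s0]) simp
    qed (use M_nonneg q_nonneg in auto)
    have "\<bar>g s\<bar> \<le> real k * (M ^ (k - 1) * (D0 * \<rho> ^ Suc (Suc n) / (1 - \<rho>)))
        + (\<Sum>l=Suc k..N. real k * (D0 / R ^ Suc (l - k) * (M ^ l * q ^ (Suc N - l))))"
      unfolding g_def
    proof (rule order.trans[OF abs_triangle_ineq add_mono])
      show "\<bar>W s - (\<Sum>p=1..Suc n. carleman_row F s p \<alpha> (mpower (x s)))\<bar>
          \<le> real k * (M ^ (k - 1) * (D0 * \<rho> ^ Suc (Suc n) / (1 - \<rho>)))"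
        unfolding W_def \<rho>_def
        using \<alpha> s0 x_le[OF s0] M_nonneg crit by (intro monomial_truncation_error) auto
      show "\<bar>\<Sum>l=Suc k..N. carleman_row F s (Suc (l - k)) \<alpha> (e l s)\<bar>
          \<le> (\<Sum>l=Suc k..N. real k * (D0 / R ^ Suc (l - k) * (M ^ l * q ^ (Suc N - l))))"
        by (rule order.trans[OF sum_abs sum_mono[OF coupling]])
    qed
    also have "M ^ (k - 1) * (D0 * \<rho> ^ Suc (Suc n) / (1 - \<rho>))
        = \<mu>0 * M ^ k * (a * \<rho> ^ Suc n / (1 - \<rho>))"
      using k R_pos \<mu>0_pos by (cases k) (simp_all add: a_def \<rho>_def mult_ac)
    also have "(\<Sum>l=Suc k..N. real k * (D0 / R ^ Suc (l - k) * (M ^ l * q ^ (Suc N - l))))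
        = (\<Sum>i=1..n. real k * (\<mu>0 * M ^ k * (a * (\<rho> ^ i * q ^ (Suc n - i)))))"
    proof (rule sum.reindex_bij_witness[of _ "\<lambda>i. i + k" "\<lambda>l. l - k"])
      fix l assume l: "l \<in> {Suc k..N}"
      define i where "i = l - k"
      have idx: "l = k + i" "Suc n - i = Suc N - l" using l k by (auto simp: i_def n_def)
      have "D0 / R ^ Suc i * M ^ l = \<mu>0 * M ^ k * (a * \<rho> ^ i)"
        using R_pos \<mu>0_pos by (simp add: idx(1) a_def \<rho>_def power_divide power_add)
      thus "real k * (\<mu>0 * M ^ k * (a * (\<rho> ^ (l - k) * q ^ (Suc n - (l - k))))) =
          real k * (D0 / R ^ Suc (l - k) * (M ^ l * q ^ (Suc N - l)))"
        unfolding i_def[symmetric] idx(2) by (metis mult.assoc)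
    qed (auto simp: n_def)
    also have "real k * (\<mu>0 * M ^ k * (a * \<rho> ^ Suc n / (1 - \<rho>))) + \<dots>
        = real k * \<mu>0 * M ^ k *
            (a * (\<Sum>i=1..n. \<rho> ^ i * q ^ (Suc n - i)) + a * \<rho> ^ Suc n / (1 - \<rho>))"
      by (simp add: sum_distrib_left distrib_left mult_ac)
    also have "\<dots> \<le> real k * \<mu>0 * M ^ k * q ^ Suc n"
      using majorant_is_supersolution[OF q q_le \<rho>] \<mu>0_pos M_nonneg
      by (intro mult_left_mono) auto
    also have "\<dots> = (real k * \<mu>0) * (M ^ k * q ^ (Suc N - k))"
      using k by (simp add: n_def Suc_diff_le)
    also have "\<dots> \<le> d * (M ^ k * q ^ (Suc N - k))"
    proof (rule mult_right_mono)
      have "real k * \<mu>0 = (\<Sum>j\<in>UNIV. real (\<alpha> j) * \<mu>0)"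
        using \<alpha> by (simp add: mindices_def flip: sum_distrib_right of_nat_sum)
      also have "\<dots> \<le> (\<Sum>j\<in>UNIV. real (\<alpha> j) * - lam $ j)"
        by (intro sum_mono mult_left_mono) (use lam_le in \<open>auto simp: le_minus_iff\<close>)
      also have "\<dots> = d" by (simp add: d_def sum_negf)
      finally show "real k * \<mu>0 \<le> d" .
    qed (use M_nonneg q_nonneg in auto)
    finally show "\<bar>g s\<bar> \<le> d * (M ^ k * q ^ (Suc N - k))" .
  qed
  thus ?case by (simp add: e_def)
qed

end

theorem theorem3p4:
  fixes f :: "real \<Rightarrow> real ^ 'd::finite \<Rightarrow> real ^ 'd"
    and F :: "'d mindex \<Rightarrow> real \<Rightarrow> real ^ 'd"
    and D0 R \<mu>0 t0 :: real
    and lam x0 :: "real ^ 'd"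
    and x :: "real \<Rightarrow> real ^ 'd"
    and N :: nat
    and y :: "nat \<Rightarrow> real \<Rightarrow> 'd mindex \<Rightarrow> real"
  assumes "D0 > 0" and "R > 0" and "\<mu>0 > 0"
    and maclaurin: "\<And>t z. t \<ge> t0 \<Longrightarrow> infnorm z < R \<Longrightarrow>
      ((\<lambda>\<alpha>. mpower z \<alpha> *\<^sub>R F \<alpha> t) has_sum f t z) (UNIV - {\<lambda>_. 0})"
    and coeff_bound: "\<And>t k. t \<ge> t0 \<Longrightarrow> k \<ge> 1 \<Longrightarrow>
      (\<Sum>j\<in>UNIV. \<Sum>\<alpha>\<in>mindices k. \<bar>F \<alpha> t $ j\<bar>) \<le> D0 / R ^ k"
    and jacobian: "\<And>t. t \<ge> t0 \<Longrightarrow>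
      (\<chi> i. F (mindex_unit i) t) = (\<chi> i j. if i = j then lam $ i else 0)"
    and lam_le: "\<And>j. lam $ j \<le> - \<mu>0"
    and ode: "\<And>t. t \<ge> t0 \<Longrightarrow> (x has_vector_derivative f t (x t)) (at t within {t0..})"
    and init: "x t0 = x0"
    and x0_pos: "0 < norm x0"
    and x0_small: "norm x0 < R\<^sup>2 * \<mu>0 / (D0 + R * \<mu>0)"
    and "N \<ge> 1"
    and fin_sec: "finite_section_solution F t0 x0 N y"
  shows "\<forall>t\<ge>t0. infnorm (first_block y t - x t)
           \<le> norm x0 * ((D0 + R * \<mu>0) * norm x0 / (R\<^sup>2 * \<mu>0)) ^ N"
proof (intro allI impI infnorm_le_cart)
  fix t i assume t: "t0 \<le> t"
  interpret dissipative_analytic_ode f F D0 R \<mu>0 t0 lam x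
    by unfold_locales (fact assms)+
  have "\<bar>mpower (x t) (mindex_unit i) - y 1 t (mindex_unit i)\<bar>
      \<le> norm x0 ^ 1 * ((D0 + R * \<mu>0) * norm x0 / (R\<^sup>2 * \<mu>0)) ^ (Suc N - 1)"
    using fin_sec init x0_small \<open>N \<ge> 1\<close> t infnorm_le_norm[of x0]
    by (intro carleman_error_le mindex_unit_in_mindices) auto
  thus "\<bar>(first_block y t - x t) $ i\<bar>
      \<le> norm x0 * ((D0 + R * \<mu>0) * norm x0 / (R\<^sup>2 * \<mu>0)) ^ N"
    by (simp add: first_block_def mpower_unit abs_minus_commute)
qed

end
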